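(* Let $(B',B)$ be a pair of spaces (i.e., $B$ is a subspace of the topological space $B'$), with inclusion $f\colon B\to B'$. Then in the commutative square $$\begin{array}{ccc} \widetilde{B} & \xrightarrow{\tilde f} & \widetilde{B}'\\ \downarrow & & \downarrow\\ B & \xrightarrow{f} & B'\end{array}$$ obtained by applying the functorial factorization described in the context to the maps $\emptyset \to B$ and $\emptyset \to B'$, the map $\tilde f\colon \widetilde{B} \to \widetilde{B}'$ is an inclusion of a subcomplex.
   Context: All maps are continuous. The factorization. Given a map $A\to B$ of topological spaces, construct a sequence $A=A_{-1}\to A_0\to A_1\to\cdots$ of spaces with compatible maps to $B$ as follows. Let $A_0=A_{-1}\amalg\coprod_{D^0\to B}D^0$, with one point for each map $D^0\to B$; the copy of $D^0$ indexed by $D^0\to B$ is mapped to $B$ by that map. For $n\ge 1$, given $A_{n-1}\to B$, let $A_n$ be obtained from $A_{n-1}$ by attaching one $n$-cell for each commutative square $$\begin{array}{ccc} S^{n-1} & \xrightarrow{\alpha} & A_{n-1}\\ \downarrow & & \downarrow\\ D^{n} & \xrightarrow{\beta} & B\end{array}$$ (left map the standard inclusion), the cell being attached along $\alpha$ and mapped to $B$ by $\beta$; that is, $A_n$ is the pushout of $\coprod D^n\leftarrow\coprod S^{n-1}\to A_{n-1}$, coproducts over all such squares. Let $\widetilde B=\operatorname{colim}_n A_n$; the factorization is $A\to\widetilde B\to B$ with the induced maps. When $A=\emptyset$, $\widetilde B$ is a CW-complex with $n$-skeleton $A_n$. Functoriality. A commutative square with vertical maps $A\to B$, $A'\to B'$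 and horizontal maps $h\colon A\to A'$, $g\colon B\to B'$ induces maps $h_n\colon A_n\to A'_n$: $h_{-1}=h$; $h_0$ is $h$ on $A_{-1}$ and sends the point indexed by $\alpha\colon D^0\to B$ to the point indexed by $g\circ\alpha$; and $h_n$ extends $h_{n-1}$ by sending the $n$-cell indexed by $(\alpha,\beta)$ identically to the $n$-cell indexed by $(h_{n-1}\circ\alpha,\,g\circ\beta)$. The induced map $\widetilde B\to\widetilde B'$ is $\operatorname{colim}_n h_n$. The map $\tilde f$ in the statement is the one induced in this way by $g=f$ with $A=A'=\emptyset$. *)

theory Defs
  imports "HOL-Analysis.Analysis"
begin

section \<open>Discs and spheres\<close>

definition disc :: "nat \<Rightarrow> (nat \<Rightarrow> real) topology"
  where "disc n = subtopology (Euclidean_space n) {x. (\<Sum>i<n. (x i)\<^sup>2) \<le> 1}"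

text \<open>The sphere of dimension \<open>n - 1\<close>, indexed by the disc it bounds so that
  \<open>n = 0\<close> gives the empty sphere; \<open>nsphere\<close> starts with the two-point sphere.\<close>

definition bsphere :: "nat \<Rightarrow> (nat \<Rightarrow> real) topology"
  where "bsphere n = subtopology (Euclidean_space n) {x. (\<Sum>i<n. (x i)\<^sup>2) = 1}"

lemma bsphere_Suc: "bsphere (Suc n) = nsphere n"
  by (simp add: bsphere_def nsphere_def lessThan_Suc_atMost)

lemma bsphere_0: "bsphere 0 = trivial_topology"
  by (simp add: bsphere_def)

lemma topspace_disc_0: "topspace (disc 0) = {\<lambda>_. 0}"
  by (auto simp: disc_def topspace_Euclidean_space)

lemma topspace_bsphere_subset: "topspace (bsphere n) \<subseteq> topspace (disc n)"
  by (auto simp: bsphere_def disc_def)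

abbreviation open_disc :: "nat \<Rightarrow> (nat \<Rightarrow> real) set"
  where "open_disc n \<equiv> topspace (disc n) - topspace (bsphere n)"


section \<open>CW-complexes, described by their characteristic maps\<close>

text \<open>\<open>X\<close> is a pushout of \<open>\<Coprod> disc n \<leftarrow> \<Coprod> bsphere n \<rightarrow> Y\<close>, where \<open>C\<close> is the set of
  characteristic maps and the attaching maps are their restrictions to \<open>bsphere n\<close>.
  Distinct members of \<open>C\<close> give distinct cells, by the bijection clause.\<close>

definition attaches_cells ::
    "nat \<Rightarrow> 'x topology \<Rightarrow> 'x topology \<Rightarrow> ((nat \<Rightarrow> real) \<Rightarrow> 'x) set \<Rightarrow> bool"
  where "attaches_cells n Y X C \<longleftrightarrow>
    topspace Y \<subseteq> topspace X \<and>
    (\<forall>\<Phi>\<in>C. continuous_map (bsphere n) Y \<Phi>) \<and>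
    bij_betw (\<lambda>(\<Phi>, x). \<Phi> x) (C \<times> open_disc n) (topspace X - topspace Y) \<and>
    (\<forall>U\<subseteq>topspace X. openin X U \<longleftrightarrow>
       openin Y (U \<inter> topspace Y) \<and>
       (\<forall>\<Phi>\<in>C. openin (disc n) {x \<in> topspace (disc n). \<Phi> x \<in> U}))"

text \<open>\<open>X\<close> is the colimit of a sequence of spaces along inclusions.\<close>

definition is_seq_colimit :: "(nat \<Rightarrow> 'x topology) \<Rightarrow> 'x topology \<Rightarrow> bool"
  where "is_seq_colimit sk X \<longleftrightarrow>
    topspace X = (\<Union>n. topspace (sk n)) \<and>
    (\<forall>U\<subseteq>topspace X. openin X U \<longleftrightarrow> (\<forall>n. openin (sk n) (U \<inter> topspace (sk n))))"

text \<open>\<open>C n\<close> is the set of characteristic maps of the \<open>n\<close>-cells. The \<open>n\<close>-skeleton is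
  \<open>sk (Suc n)\<close>, so that \<open>sk 0\<close> is the empty skeleton of dimension \<open>-1\<close>.\<close>

definition CW_complex :: "'x topology \<Rightarrow> (nat \<Rightarrow> ((nat \<Rightarrow> real) \<Rightarrow> 'x) set) \<Rightarrow> bool"
  where "CW_complex X C \<longleftrightarrow>
    (\<exists>sk. sk 0 = trivial_topology \<and>
          (\<forall>n. attaches_cells n (sk n) (sk (Suc n)) (C n)) \<and>
          is_seq_colimit sk X)"

definition open_cells :: "(nat \<Rightarrow> ((nat \<Rightarrow> real) \<Rightarrow> 'x) set) \<Rightarrow> nat \<Rightarrow> 'x set set"
  where "open_cells C n = (\<lambda>\<Phi>. \<Phi> ` open_disc n) ` C n"

definition subcomplex ::
    "'x topology \<Rightarrow> (nat \<Rightarrow> ((nat \<Rightarrow> real) \<Rightarrow> 'x) set) \<Rightarrow> 'x set \<Rightarrow> bool"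
  where "subcomplex X C Y \<longleftrightarrow>
    closedin X Y \<and> (\<exists>K \<subseteq> (\<Union>n. open_cells C n). Y = \<Union>K)"

definition inclusion_of_subcomplex ::
    "'x topology \<Rightarrow> (nat \<Rightarrow> ((nat \<Rightarrow> real) \<Rightarrow> 'x) set) \<Rightarrow>
     'y topology \<Rightarrow> (nat \<Rightarrow> ((nat \<Rightarrow> real) \<Rightarrow> 'y) set) \<Rightarrow> ('x \<Rightarrow> 'y) \<Rightarrow> bool"
  where "inclusion_of_subcomplex X C X' C' f \<longleftrightarrow>
    CW_complex X C \<and> CW_complex X' C' \<and>
    embedding_map X X' f \<and>
    subcomplex X' C' (f ` topspace X) \<and>
    (\<forall>n. \<forall>e\<in>open_cells C n. f ` e \<in> open_cells C' n)"


section \<open>The factorization\<close>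

text \<open>One type contains the points of all stages: \<open>Base a\<close> is a point of the space \<open>A\<close>
  one starts from, and \<open>Cell n \<alpha> \<beta> x\<close> is the point \<open>x\<close> of the open disc in the \<open>n\<close>-cell
  indexed by the square \<open>(\<alpha>, \<beta>)\<close>.\<close>

datatype ('a, 'b) pt =
    Base 'a
  | Cell nat "(nat \<Rightarrow> real) \<Rightarrow> ('a, 'b) pt" "(nat \<Rightarrow> real) \<Rightarrow> 'b" "nat \<Rightarrow> real"

primrec proj :: "('a \<Rightarrow> 'b) \<Rightarrow> ('a, 'b) pt \<Rightarrow> 'b"
  where
    "proj p (Base a) = p a"
  | "proj p (Cell n \<alpha> \<beta> x) = \<beta> x"

text \<open>Maps out of \<open>bsphere n\<close> and \<open>disc n\<close> are represented by functions that are extensional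
  on these sets, so that each commutative square is counted exactly once.\<close>

definition squares :: "nat \<Rightarrow> ('a, 'b) pt topology \<Rightarrow> ('a \<Rightarrow> 'b) \<Rightarrow> 'b topology \<Rightarrow>
    (((nat \<Rightarrow> real) \<Rightarrow> ('a, 'b) pt) \<times> ((nat \<Rightarrow> real) \<Rightarrow> 'b)) set"
  where "squares n Y p B =
    {(\<alpha>, \<beta>). \<alpha> \<in> extensional (topspace (bsphere n)) \<and> continuous_map (bsphere n) Y \<alpha> \<and>
             \<beta> \<in> extensional (topspace (disc n)) \<and> continuous_map (disc n) B \<beta> \<and>
             (\<forall>s \<in> topspace (bsphere n). proj p (\<alpha> s) = \<beta> s)}"

definition char_map :: "nat \<Rightarrow> ((nat \<Rightarrow> real) \<Rightarrow> ('a, 'b) pt) \<Rightarrow> ((nat \<Rightarrow> real) \<Rightarrow> 'b) \<Rightarrow>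
    (nat \<Rightarrow> real) \<Rightarrow> ('a, 'b) pt"
  where "char_map n \<alpha> \<beta> =
    (\<lambda>x \<in> topspace (disc n). if x \<in> topspace (bsphere n) then \<alpha> x else Cell n \<alpha> \<beta> x)"

definition attach_set :: "nat \<Rightarrow> ('a, 'b) pt topology \<Rightarrow> ('a \<Rightarrow> 'b) \<Rightarrow> 'b topology \<Rightarrow> ('a, 'b) pt set"
  where "attach_set n Y p B =
    topspace Y \<union> {Cell n \<alpha> \<beta> x | \<alpha> \<beta> x. (\<alpha>, \<beta>) \<in> squares n Y p B \<and> x \<in> open_disc n}"

text \<open>The pushout topology; see \<open>continuous_map_attach\<close> and \<open>attach_pushout\<close> below.\<close>

definition attach :: "nat \<Rightarrow> ('a, 'b) pt topology \<Rightarrow> ('a \<Rightarrow> 'b) \<Rightarrow> 'b topology \<Rightarrow> ('a, 'b) pt topology"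
  where "attach n Y p B = topology (\<lambda>U.
    U \<subseteq> attach_set n Y p B \<and>
    openin Y (U \<inter> topspace Y) \<and>
    (\<forall>(\<alpha>, \<beta>) \<in> squares n Y p B.
       openin (disc n) {x \<in> topspace (disc n). char_map n \<alpha> \<beta> x \<in> U}))"

text \<open>Here \<open>stage A p B n\<close> is the space written \<open>A\<^sub>n\<^sub>-\<^sub>1\<close> in the usual indexing, where
  \<open>A\<^sub>-\<^sub>1 = A\<close>. As \<open>bsphere 0\<close> is empty, passing to \<open>A\<^sub>0\<close> adds one isolated point for each
  map from \<open>disc 0\<close> to \<open>B\<close>.\<close>

primrec stage :: "'a topology \<Rightarrow> ('a \<Rightarrow> 'b) \<Rightarrow> 'b topology \<Rightarrow> nat \<Rightarrow> ('a, 'b) pt topology"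
  where
    "stage A p B 0 = topology (\<lambda>U. U \<subseteq> Base ` topspace A \<and> openin A {a \<in> topspace A. Base a \<in> U})"
  | "stage A p B (Suc n) = attach n (stage A p B n) p B"

definition factor_space :: "'a topology \<Rightarrow> ('a \<Rightarrow> 'b) \<Rightarrow> 'b topology \<Rightarrow> ('a, 'b) pt topology"
  where "factor_space A p B = topology (\<lambda>U.
    U \<subseteq> (\<Union>n. topspace (stage A p B n)) \<and>
    (\<forall>n. openin (stage A p B n) (U \<inter> topspace (stage A p B n))))"

definition factor_cells ::
    "'a topology \<Rightarrow> ('a \<Rightarrow> 'b) \<Rightarrow> 'b topology \<Rightarrow> nat \<Rightarrow> ((nat \<Rightarrow> real) \<Rightarrow> ('a, 'b) pt) set"
  where "factor_cells A p B n =
    (\<lambda>(\<alpha>, \<beta>). char_map n \<alpha> \<beta>) ` squares n (stage A p B n) p B"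

text \<open>The map induced by \<open>h : A \<rightarrow> A'\<close> and \<open>g : B \<rightarrow> B'\<close>, on all stages at once: the map
  from \<open>stage A p B n\<close> to \<open>stage A' p' B' n\<close> is its restriction, since \<open>Cell n \<alpha> \<beta> x\<close> is sent
  to the same point \<open>x\<close> of the \<open>n\<close>-cell indexed by the two composites.\<close>

primrec induced :: "('a \<Rightarrow> 'c) \<Rightarrow> ('b \<Rightarrow> 'd) \<Rightarrow> ('a, 'b) pt \<Rightarrow> ('c, 'd) pt"
  where
    "induced h g (Base a) = Base (h a)"
  | "induced h g (Cell n \<alpha> \<beta> x) =
       Cell n (restrict (induced h g \<circ> \<alpha>) (topspace (bsphere n)))
              (restrict (g \<circ> \<beta>) (topspace (disc n))) x"

text \<open>The case where \<open>A\<close> is empty; the map from \<open>A\<close> to \<open>B\<close> is then irrelevant.\<close>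

definition tilde :: "'b topology \<Rightarrow> (unit, 'b) pt topology"
  where "tilde B = factor_space trivial_topology (\<lambda>_. undefined) B"

definition tilde_cells :: "'b topology \<Rightarrow> nat \<Rightarrow> ((nat \<Rightarrow> real) \<Rightarrow> (unit, 'b) pt) set"
  where "tilde_cells B = factor_cells trivial_topology (\<lambda>_. undefined) B"

definition tilde_proj :: "(unit, 'b) pt \<Rightarrow> 'b"
  where "tilde_proj = proj (\<lambda>_. undefined)"

definition tilde_map :: "('b \<Rightarrow> 'd) \<Rightarrow> (unit, 'b) pt \<Rightarrow> (unit, 'd) pt"
  where "tilde_map g = induced id g"


section \<open>Basic properties of the construction\<close>

lemma char_map_in_attach_set:
  assumes "(\<alpha>, \<beta>) \<in> squares n Y p B" "x \<in> topspace (disc n)"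
  shows "char_map n \<alpha> \<beta> x \<in> attach_set n Y p B"
proof (cases "x \<in> topspace (bsphere n)")
  case True
  moreover have "continuous_map (bsphere n) Y \<alpha>"
    using assms(1) by (simp add: squares_def)
  ultimately have "\<alpha> x \<in> topspace Y"
    by (auto simp: continuous_map_def)
  with True assms show ?thesis
    by (simp add: char_map_def attach_set_def)
next
  case False
  with assms show ?thesis
    by (auto simp: char_map_def attach_set_def)
qed

lemma openin_attach:
  "openin (attach n Y p B) U \<longleftrightarrow>
    U \<subseteq> attach_set n Y p B \<and>
    openin Y (U \<inter> topspace Y) \<and>
    (\<forall>(\<alpha>, \<beta>) \<in> squares n Y p B.
       openin (disc n) {x \<in> topspace (disc n). char_map n \<alpha> \<beta> x \<in> U})"
proof -
  let ?P = "\<lambda>U. U \<subseteq> attach_set n Y p B \<and> openin Y (U \<inter> topspace Y) \<and>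
    (\<forall>(\<alpha>, \<beta>) \<in> squares n Y p B.
       openin (disc n) {x \<in> topspace (disc n). char_map n \<alpha> \<beta> x \<in> U})"
  have "istopology ?P"
    unfolding istopology_def
  proof (intro conjI allI impI)
    fix S T assume S: "?P S" and T: "?P T"
    have "S \<inter> T \<inter> topspace Y = (S \<inter> topspace Y) \<inter> (T \<inter> topspace Y)" by auto
    moreover have "{x \<in> topspace (disc n). char_map n \<alpha> \<beta> x \<in> S \<inter> T} =
        {x \<in> topspace (disc n). char_map n \<alpha> \<beta> x \<in> S} \<inter>
        {x \<in> topspace (disc n). char_map n \<alpha> \<beta> x \<in> T}" for \<alpha> \<beta> by auto
    ultimately show "S \<inter> T \<subseteq> attach_set n Y p B" "openin Y (S \<inter> T \<inter> topspace Y)"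
      "\<forall>(\<alpha>, \<beta>) \<in> squares n Y p B.
       openin (disc n) {x \<in> topspace (disc n). char_map n \<alpha> \<beta> x \<in> S \<inter> T}"
      using S T by (auto intro!: openin_Int)
  next
    fix K assume K: "\<forall>S\<in>K. ?P S"
    have "\<Union>K \<inter> topspace Y = \<Union>((\<lambda>S. S \<inter> topspace Y) ` K)" by auto
    moreover have "{x \<in> topspace (disc n). char_map n \<alpha> \<beta> x \<in> \<Union>K} =
        \<Union>((\<lambda>S. {x \<in> topspace (disc n). char_map n \<alpha> \<beta> x \<in> S}) ` K)" for \<alpha> \<beta> by auto
    moreover have "openin Y (\<Union>((\<lambda>S. S \<inter> topspace Y) ` K))"
      using K by (intro openin_Union) blast
    moreover have "openin (disc n)
        (\<Union>((\<lambda>S. {x \<in> topspace (disc n). char_map n \<alpha> \<beta> x \<in> S}) ` K))"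
      if "(\<alpha>, \<beta>) \<in> squares n Y p B" for \<alpha> \<beta>
      using K that by (intro openin_Union) blast
    moreover show "\<Union>K \<subseteq> attach_set n Y p B"
      using K by blast
    ultimately show "openin Y (\<Union>K \<inter> topspace Y)"
      "\<forall>(\<alpha>, \<beta>) \<in> squares n Y p B.
       openin (disc n) {x \<in> topspace (disc n). char_map n \<alpha> \<beta> x \<in> \<Union>K}"
      by auto
  qed
  then show ?thesis
    by (simp add: attach_def topology_inverse')
qed

lemma topspace_attach: "topspace (attach n Y p B) = attach_set n Y p B"
proof (rule subset_antisym)
  show "topspace (attach n Y p B) \<subseteq> attach_set n Y p B"
    using openin_attach openin_topspace by blast
  have "attach_set n Y p B \<inter> topspace Y = topspace Y"
    by (auto simp: attach_set_def)
  moreover have "{x \<in> topspace (disc n). char_map n \<alpha> \<beta> x \<in> attach_set n Y p B} = topspace (disc n)"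
    if "(\<alpha>, \<beta>) \<in> squares n Y p B" for \<alpha> \<beta>
    using char_map_in_attach_set[OF that] by auto
  ultimately have "openin (attach n Y p B) (attach_set n Y p B)"
    by (auto simp: openin_attach)
  then show "attach_set n Y p B \<subseteq> topspace (attach n Y p B)"
    by (rule openin_subset)
qed

lemma continuous_map_into_attach: "continuous_map Y (attach n Y p B) (\<lambda>y. y)"
  unfolding continuous_map_alt
  by (auto simp: openin_attach topspace_attach attach_set_def vimage_def Int_commute)

lemma continuous_map_char_map:
  assumes "(\<alpha>, \<beta>) \<in> squares n Y p B"
  shows "continuous_map (disc n) (attach n Y p B) (char_map n \<alpha> \<beta>)"
  using assms char_map_in_attach_set[OF assms]
  by (fastforce simp: continuous_map_def openin_attach topspace_attach)

lemma continuous_map_attach: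
  "continuous_map (attach n Y p B) Z k \<longleftrightarrow>
    continuous_map Y Z k \<and>
    (\<forall>(\<alpha>, \<beta>) \<in> squares n Y p B. continuous_map (disc n) Z (k \<circ> char_map n \<alpha> \<beta>))"
  (is "?L \<longleftrightarrow> ?R")
proof
  assume L: ?L
  have "continuous_map Y Z (k \<circ> (\<lambda>y. y))"
    by (rule continuous_map_compose[OF continuous_map_into_attach L])
  then show ?R
    using continuous_map_compose[OF continuous_map_char_map L] by (auto simp: o_def)
next
  assume R: ?R
  show ?L
    unfolding continuous_map_def
  proof (intro conjI allI impI)
    show "k \<in> topspace (attach n Y p B) \<rightarrow> topspace Z"
    proof
      fix y assume "y \<in> topspace (attach n Y p B)"
      then consider "y \<in> topspace Y"
        | \<alpha> \<beta> x where "(\<alpha>, \<beta>) \<in> squares n Y p B" "x \<in> open_disc n" "y = Cell n \<alpha> \<beta> x"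
        by (auto simp: topspace_attach attach_set_def)
      then show "k y \<in> topspace Z"
      proof cases
        case 1 with R show ?thesis by (auto simp: continuous_map_def)
      next
        case 2
        then have "y = char_map n \<alpha> \<beta> x" by (simp add: char_map_def)
        moreover have "continuous_map (disc n) Z (k \<circ> char_map n \<alpha> \<beta>)"
          using R 2(1) by blast
        ultimately show ?thesis
          using 2(2) by (auto simp: continuous_map_def Pi_iff)
      qed
    qed
  next
    fix U assume U: "openin Z U"
    let ?V = "{x \<in> topspace (attach n Y p B). k x \<in> U}"
    have "?V \<inter> topspace Y = {y \<in> topspace Y. k y \<in> U}"
      by (auto simp: topspace_attach attach_set_def)
    moreover have "{x \<in> topspace (disc n). char_map n \<alpha> \<beta> x \<in> ?V} =
        {x \<in> topspace (disc n). (k \<circ> char_map n \<alpha> \<beta>) x \<in> U}"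
      if "(\<alpha>, \<beta>) \<in> squares n Y p B" for \<alpha> \<beta>
      using char_map_in_attach_set[OF that] by (auto simp: topspace_attach)
    moreover have "openin Y {y \<in> topspace Y. k y \<in> U}"
      using R U by (auto simp: continuous_map_def)
    moreover have "openin (disc n) {x \<in> topspace (disc n). (k \<circ> char_map n \<alpha> \<beta>) x \<in> U}"
      if "(\<alpha>, \<beta>) \<in> squares n Y p B" for \<alpha> \<beta>
      using R U that unfolding continuous_map_def by blast
    ultimately show "openin (attach n Y p B) ?V"
      by (auto simp: openin_attach topspace_attach[symmetric])
  qed
qed

lemma attach_pushout:
  assumes new: "\<And>\<alpha> \<beta> x. Cell n \<alpha> \<beta> x \<notin> topspace Y"
    and u: "continuous_map Y Z u"
    and v: "\<And>\<alpha> \<beta>. (\<alpha>, \<beta>) \<in> squares n Y p B \<Longrightarrow> continuous_map (disc n) Z (v \<alpha> \<beta>)"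
    and uv: "\<And>\<alpha> \<beta> s. (\<alpha>, \<beta>) \<in> squares n Y p B \<Longrightarrow> s \<in> topspace (bsphere n) \<Longrightarrow> u (\<alpha> s) = v \<alpha> \<beta> s"
  shows "\<exists>!k. k \<in> extensional (topspace (attach n Y p B)) \<and>
    continuous_map (attach n Y p B) Z k \<and>
    (\<forall>y \<in> topspace Y. k y = u y) \<and>
    (\<forall>(\<alpha>, \<beta>) \<in> squares n Y p B. \<forall>x \<in> topspace (disc n). k (char_map n \<alpha> \<beta> x) = v \<alpha> \<beta> x)"
    (is "\<exists>!k. ?Q k")
proof
  define k where "k = (\<lambda>y \<in> topspace (attach n Y p B).
    if y \<in> topspace Y then u y else (case y of Base a \<Rightarrow> undefined | Cell m \<alpha> \<beta> x \<Rightarrow> v \<alpha> \<beta> x))"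
  have kY: "k y = u y" if "y \<in> topspace Y" for y
    using that by (simp add: k_def topspace_attach attach_set_def)
  have kc: "k (char_map n \<alpha> \<beta> x) = v \<alpha> \<beta> x"
    if sq: "(\<alpha>, \<beta>) \<in> squares n Y p B" and x: "x \<in> topspace (disc n)" for \<alpha> \<beta> x
  proof (cases "x \<in> topspace (bsphere n)")
    case True
    have "continuous_map (bsphere n) Y \<alpha>" using sq by (simp add: squares_def)
    then have "\<alpha> x \<in> topspace Y" using True by (auto simp: continuous_map_def)
    then show ?thesis using True x uv[OF sq True] by (simp add: char_map_def kY)
  next
    case False
    then show ?thesis
      using char_map_in_attach_set[OF sq x] x new by (simp add: k_def char_map_def topspace_attach)
  qed
  have "continuous_map Y Z k"
    using u kY continuous_map_eq by metis
  moreover have "continuous_map (disc n) Z (k \<circ> char_map n \<alpha> \<beta>)"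
    if "(\<alpha>, \<beta>) \<in> squares n Y p B" for \<alpha> \<beta>
    by (rule continuous_map_eq[OF v[OF that]]) (simp add: kc[OF that])
  ultimately show "?Q k"
    using kY kc unfolding continuous_map_attach by (auto simp only: k_def restrict_extensional)
  fix k' assume k': "?Q k'"
  show "k' = k"
  proof (rule extensionalityI)
    show "k' \<in> extensional (topspace (attach n Y p B))" using k' by simp
    show "k \<in> extensional (topspace (attach n Y p B))" by (simp add: k_def)
    fix y assume "y \<in> topspace (attach n Y p B)"
    then consider "y \<in> topspace Y"
      | \<alpha> \<beta> x where "(\<alpha>, \<beta>) \<in> squares n Y p B" "x \<in> open_disc n" "y = Cell n \<alpha> \<beta> x"
      by (auto simp: topspace_attach attach_set_def)
    then show "k' y = k y"
    proof cases
      case 1 then show ?thesis using k' kY by simp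
    next
      case 2
      then have y: "y = char_map n \<alpha> \<beta> x" by (simp add: char_map_def)
      have "k' (char_map n \<alpha> \<beta> x) = v \<alpha> \<beta> x" using k' 2 by blast
      then show ?thesis using kc[OF 2(1), of x] 2 y by simp
    qed
  qed
qed

lemma openin_stage_0:
  "openin (stage A p B 0) U \<longleftrightarrow> U \<subseteq> Base ` topspace A \<and> openin A {a \<in> topspace A. Base a \<in> U}"
proof -
  have "istopology (\<lambda>U :: ('a, 'b) pt set. U \<subseteq> Base ` topspace A \<and> openin A {a \<in> topspace A. Base a \<in> U})"
    unfolding istopology_def
  proof (intro conjI allI impI)
    fix S T :: "('a, 'b) pt set"
    assume "S \<subseteq> Base ` topspace A \<and> openin A {a \<in> topspace A. Base a \<in> S}"
      "T \<subseteq> Base ` topspace A \<and> openin A {a \<in> topspace A. Base a \<in> T}"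
    moreover have "{a \<in> topspace A. Base a \<in> S \<inter> T} =
      {a \<in> topspace A. Base a \<in> S} \<inter> {a \<in> topspace A. Base a \<in> T}" by auto
    ultimately show "S \<inter> T \<subseteq> Base ` topspace A" "openin A {a \<in> topspace A. Base a \<in> S \<inter> T}"
      by auto
  next
    fix K :: "('a, 'b) pt set set"
    assume "\<forall>S\<in>K. S \<subseteq> Base ` topspace A \<and> openin A {a \<in> topspace A. Base a \<in> S}"
    moreover have "{a \<in> topspace A. Base a \<in> \<Union>K} = \<Union>((\<lambda>S. {a \<in> topspace A. Base a \<in> S}) ` K)"
      by auto
    moreover from calculation have "openin A (\<Union>((\<lambda>S. {a \<in> topspace A. Base a \<in> S}) ` K))"
      by (intro openin_Union) blast
    ultimately show "\<Union>K \<subseteq> Base ` topspace A" "openin A {a \<in> topspace A. Base a \<in> \<Union>K}"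
      by auto
  qed
  then show ?thesis
    by (simp add: topology_inverse')
qed

lemma topspace_stage_0: "topspace (stage A p B 0) = Base ` topspace A"
proof (rule subset_antisym)
  show "topspace (stage A p B 0) \<subseteq> Base ` topspace A"
    using openin_stage_0 openin_topspace by blast
  have "{a \<in> topspace A. (Base a :: ('a, 'b) pt) \<in> Base ` topspace A} = topspace A" by auto
  then have "openin (stage A p B 0) (Base ` topspace A)"
    unfolding openin_stage_0 by simp
  then show "Base ` topspace A \<subseteq> topspace (stage A p B 0)"
    by (rule openin_subset)
qed

lemma homeomorphic_map_Base: "homeomorphic_map A (stage A p B 0) Base"
proof (rule bijective_open_imp_homeomorphic_map)
  have "{x \<in> topspace A. Base x \<in> U} = {a \<in> topspace A. Base a \<in> U}" for U :: "('a, 'b) pt set"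
    by simp
  then show "continuous_map A (stage A p B 0) Base"
    unfolding continuous_map_def topspace_stage_0 by (auto simp only: openin_stage_0)
  show "open_map A (stage A p B 0) Base"
    unfolding open_map_def
  proof (intro allI impI)
    fix U assume U: "openin A U"
    then have "{a \<in> topspace A. (Base a :: ('a, 'b) pt) \<in> Base ` U} = U"
      using openin_subset[OF U] by auto
    then show "openin (stage A p B 0) (Base ` U)"
      unfolding openin_stage_0 using U openin_subset[OF U] by (auto simp: image_mono)
  qed
  show "Base ` topspace A = topspace (stage A p B 0)"
    by (simp only: topspace_stage_0)
  show "inj_on Base (topspace A)"
    by (simp add: inj_on_def)
qed

lemma stage_cells_below:
  "Cell m \<alpha> \<beta> x \<in> topspace (stage A p B n) \<Longrightarrow> m < n"
  by (induction n) (auto simp: topspace_stage_0 topspace_attach attach_set_def simp del: stage.simps(1))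

lemma is_seq_colimit_factor_space: "is_seq_colimit (stage A p B) (factor_space A p B)"
proof -
  let ?T = "\<lambda>n. topspace (stage A p B n)"
  let ?P = "\<lambda>U. U \<subseteq> (\<Union>n. ?T n) \<and> (\<forall>n. openin (stage A p B n) (U \<inter> ?T n))"
  have "istopology ?P"
    unfolding istopology_def
  proof (intro conjI allI impI)
    fix S T n assume S: "?P S" and T: "?P T"
    show "S \<inter> T \<subseteq> (\<Union>n. ?T n)" using S by auto
    have "S \<inter> T \<inter> ?T n = (S \<inter> ?T n) \<inter> (T \<inter> ?T n)" by auto
    then show "openin (stage A p B n) (S \<inter> T \<inter> ?T n)" using S T by auto
  next
    fix K n assume K: "\<forall>S\<in>K. ?P S"
    show "\<Union>K \<subseteq> (\<Union>n. ?T n)" using K by blast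
    have "\<Union>K \<inter> ?T n = \<Union>((\<lambda>S. S \<inter> ?T n) ` K)" by auto
    moreover have "openin (stage A p B n) (\<Union>((\<lambda>S. S \<inter> ?T n) ` K))"
      using K by (intro openin_Union) blast
    ultimately show "openin (stage A p B n) (\<Union>K \<inter> ?T n)" by simp
  qed
  then have op: "openin (factor_space A p B) U \<longleftrightarrow> ?P U" for U
    unfolding factor_space_def by (simp add: topology_inverse')
  have "(\<Union>n. ?T n) \<inter> ?T m = ?T m" for m by auto
  then have "openin (factor_space A p B) (\<Union>n. ?T n)"
    unfolding op by simp
  then have "topspace (factor_space A p B) = (\<Union>n. ?T n)"
    using op openin_subset openin_topspace by (metis subset_antisym)
  then show ?thesis
    by (auto simp: is_seq_colimit_def op)
qed

lemma continuous_map_seq_colimit: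
  assumes "is_seq_colimit sk X"
  shows "continuous_map X Z k \<longleftrightarrow> (\<forall>n. continuous_map (sk n) Z k)"
proof -
  have top: "topspace X = (\<Union>n. topspace (sk n))"
    and op: "\<And>U. U \<subseteq> topspace X \<Longrightarrow>
      openin X U \<longleftrightarrow> (\<forall>n. openin (sk n) (U \<inter> topspace (sk n)))"
    using assms by (auto simp: is_seq_colimit_def)
  have "{x \<in> topspace X. k x \<in> U} \<inter> topspace (sk n) = {x \<in> topspace (sk n). k x \<in> U}" for U n
    using top by auto
  moreover have "{x \<in> topspace X. k x \<in> U} \<subseteq> topspace X" for U
    by auto
  ultimately have "openin X {x \<in> topspace X. k x \<in> U} \<longleftrightarrow>
      (\<forall>n. openin (sk n) {x \<in> topspace (sk n). k x \<in> U})" for U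
    using op by presburger
  then show ?thesis
    using top by (auto simp: continuous_map_def Pi_iff)
qed

lemma squareD:
  assumes "(\<alpha>, \<beta>) \<in> squares n Y p B"
  shows "continuous_map (bsphere n) Y \<alpha>" "continuous_map (disc n) B \<beta>"
    "\<And>s. s \<in> topspace (bsphere n) \<Longrightarrow> proj p (\<alpha> s) = \<beta> s"
  using assms by (auto simp: squares_def)

lemma proj_char_map:
  assumes "(\<alpha>, \<beta>) \<in> squares n Y p B" "x \<in> topspace (disc n)"
  shows "proj p (char_map n \<alpha> \<beta> x) = \<beta> x"
  using assms by (auto simp: char_map_def squareD)

lemma continuous_map_proj_stage:
  assumes "continuous_map A B p"
  shows "continuous_map (stage A p B n) B (proj p)"
proof (induction n)
  case 0
  have "p x \<in> topspace B" if "x \<in> topspace A" for x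
    using assms that by (auto simp: continuous_map_def)
  moreover have "{a \<in> topspace A. (Base a :: ('a, 'b) pt) \<in> {x \<in> Base ` topspace A. proj p x \<in> U}}
      = {a \<in> topspace A. p a \<in> U}" for U
    by auto
  ultimately show ?case
    using assms unfolding continuous_map_def topspace_stage_0 openin_stage_0 by auto
next
  case (Suc n)
  have "continuous_map (disc n) B (proj p \<circ> char_map n \<alpha> \<beta>)"
    if "(\<alpha>, \<beta>) \<in> squares n (stage A p B n) p B" for \<alpha> \<beta>
    by (rule continuous_map_eq[OF squareD(2)[OF that]]) (simp add: proj_char_map[OF that])
  with Suc show ?case
    by (auto simp: continuous_map_attach)
qed

theorem continuous_map_proj:
  assumes "continuous_map A B p"
  shows "continuous_map (factor_space A p B) B (proj p)"
  using continuous_map_proj_stage[OF assms] continuous_map_seq_colimit[OF is_seq_colimit_factor_space]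
  by blast

lemma proj_induced_stage:
  assumes "\<And>a. a \<in> topspace A \<Longrightarrow> p' (h a) = g (p a)"
    and "y \<in> topspace (stage A p B n)"
  shows "proj p' (induced h g y) = g (proj p y)"
  using assms(2)
proof (induction n)
  case 0
  then show ?case using assms(1) unfolding topspace_stage_0 by auto
next
  case (Suc n)
  then show ?case by (auto simp: topspace_attach attach_set_def)
qed

lemma induced_stage:
  assumes h: "continuous_map A A' h" and g: "continuous_map B B' g"
    and hg: "\<And>a. a \<in> topspace A \<Longrightarrow> p' (h a) = g (p a)"
  shows "continuous_map (stage A p B n) (stage A' p' B' n) (induced h g)"
proof (induction n)
  case 0
  have "continuous_map A (stage A' p' B' 0) (Base \<circ> h)"
    by (rule continuous_map_compose[OF h homeomorphic_imp_continuous_map[OF homeomorphic_map_Base]])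
  then have *: "continuous_map A (stage A' p' B' 0) (induced h g \<circ> Base)"
    by (simp add: o_def del: stage.simps)
  have "quotient_map A (stage A p B 0) Base"
    using homeomorphic_map_Base unfolding homeomorphic_map_def by blast
  then show ?case
    using * by (rule continuous_compose_quotient_map)
next
  case (Suc n)
  let ?Y = "stage A p B n" and ?Y' = "stage A' p' B' n"
  have "continuous_map ?Y (attach n ?Y' p' B') ((\<lambda>y. y) \<circ> induced h g)"
    by (rule continuous_map_compose[OF Suc.IH continuous_map_into_attach])
  moreover have "continuous_map (disc n) (attach n ?Y' p' B') (induced h g \<circ> char_map n \<alpha> \<beta>)"
    if sq: "(\<alpha>, \<beta>) \<in> squares n ?Y p B" for \<alpha> \<beta>
  proof -
    let ?a = "restrict (induced h g \<circ> \<alpha>) (topspace (bsphere n))"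
    let ?b = "restrict (g \<circ> \<beta>) (topspace (disc n))"
    have "continuous_map (bsphere n) ?Y' ?a"
      by (rule continuous_map_eq[OF continuous_map_compose[OF squareD(1)[OF sq] Suc.IH]]) simp
    moreover have "continuous_map (disc n) B' ?b"
      by (rule continuous_map_eq[OF continuous_map_compose[OF squareD(2)[OF sq] g]]) simp
    moreover have "proj p' (?a s) = ?b s" if s: "s \<in> topspace (bsphere n)" for s
    proof -
      have "\<alpha> s \<in> topspace ?Y"
        using squareD(1)[OF sq] s by (auto simp: continuous_map_def)
      then have "proj p' (induced h g (\<alpha> s)) = g (\<beta> s)"
        using proj_induced_stage[of A p' h g p "\<alpha> s" B n] hg squareD(3)[OF sq s] by simp
      then show ?thesis
        using s topspace_bsphere_subset by auto
    qed
    ultimately have sq': "(?a, ?b) \<in> squares n ?Y' p' B'"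
      by (simp add: squares_def)
    show ?thesis
      by (rule continuous_map_eq[OF continuous_map_char_map[OF sq']]) (simp add: char_map_def)
  qed
  ultimately show ?case
    by (auto simp: continuous_map_attach o_def)
qed

theorem continuous_map_induced:
  assumes "continuous_map A A' h" "continuous_map B B' g"
    and "\<And>a. a \<in> topspace A \<Longrightarrow> p' (h a) = g (p a)"
  shows "continuous_map (factor_space A p B) (factor_space A' p' B') (induced h g)"
proof -
  have "continuous_map (stage A' p' B' n) (factor_space A' p' B') (\<lambda>y. y)" for n
    using continuous_map_seq_colimit[OF is_seq_colimit_factor_space,
        of A' p' B' "factor_space A' p' B'" "\<lambda>y. y"]
    by simp
  moreover have "continuous_map (stage A p B n) (stage A' p' B' n) (induced h g)" for n
    using assms by (rule induced_stage)
  ultimately have "continuous_map (stage A p B n) (factor_space A' p' B') ((\<lambda>y. y) \<circ> induced h g)" for n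
    by (metis continuous_map_compose)
  then show ?thesis
    by (simp add: continuous_map_seq_colimit[OF is_seq_colimit_factor_space] o_def)
qed

theorem tilde_square:
  assumes "continuous_map B B' g"
  shows "continuous_map (tilde B) B tilde_proj"
    and "continuous_map (tilde B) (tilde B') (tilde_map g)"
    and "y \<in> topspace (tilde B) \<Longrightarrow> tilde_proj (tilde_map g y) = g (tilde_proj y)"
proof -
  show "continuous_map (tilde B) B tilde_proj"
    unfolding tilde_def tilde_proj_def by (rule continuous_map_proj) simp
  show "continuous_map (tilde B) (tilde B') (tilde_map g)"
    unfolding tilde_def tilde_map_def by (rule continuous_map_induced[OF _ assms]) auto
  assume "y \<in> topspace (tilde B)"
  then obtain n where "y \<in> topspace (stage trivial_topology (\<lambda>_::unit. undefined) B n)"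
    using is_seq_colimit_factor_space[of trivial_topology "\<lambda>_::unit. undefined" B]
    by (auto simp: is_seq_colimit_def tilde_def)
  from proj_induced_stage[OF _ this]
  show "tilde_proj (tilde_map g y) = g (tilde_proj y)"
    by (simp add: tilde_proj_def tilde_map_def)
qed

end

theory Submission
  imports Defs
begin

text \<open>Restricting \<open>B\<close> to a subspace \<open>S\<close> only removes squares, and the induced map is literally the
  inclusion of the set of remaining points. It is a closed map at every stage: if \<open>C\<close> is closed in
  the smaller stage and \<open>(\<alpha>, \<beta>)\<close> is a square over \<open>B\<close> but not over \<open>S\<close>, then \<open>C\<close> contains no
  interior point of the cell of \<open>(\<alpha>, \<beta>)\<close>, so its preimage in the disc lies in the sphere, where it
  is closed by continuity of \<open>\<alpha>\<close>. Closedness passes to the colimit, since the cells of dimension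
  below \<open>n\<close> are exactly those present at stage \<open>n\<close>.\<close>

section \<open>The sphere as a closed subspace of the disc\<close>

lemma bsphere_eq_subtopology: "bsphere n = subtopology (disc n) (topspace (bsphere n))"
proof -
  \<comment> \<open>A subtopology depends only on the part of the set inside the carrier, so
    agreement there is enough.\<close>
  have "topspace (Euclidean_space n) \<inter>
      ({x. (\<Sum>i<n. (x i)\<^sup>2) \<le> 1} \<inter> topspace (bsphere n)) =
      topspace (Euclidean_space n) \<inter> {x. (\<Sum>i<n. (x i)\<^sup>2) = 1}"
    by (auto simp: bsphere_def)
  then show ?thesis
    unfolding disc_def subtopology_subtopology bsphere_def by (metis subtopology_restrict)
qed

lemma closedin_bsphere: "closedin (disc n) (topspace (bsphere n))"
proof -
  have "continuous_map (Euclidean_space n) euclideanreal (\<lambda>x. \<Sum>i<n. (x i)\<^sup>2)"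
    unfolding Euclidean_space_def
    by (intro continuous_intros continuous_map_from_subtopology continuous_map_product_projection)
      simp_all
  then have "continuous_map (disc n) euclideanreal (\<lambda>x. \<Sum>i<n. (x i)\<^sup>2)"
    unfolding disc_def by (rule continuous_map_from_subtopology)
  from closedin_continuous_map_preimage[OF this, of "{1}"]
  have "closedin (disc n) {x \<in> topspace (disc n). (\<Sum>i<n. (x i)\<^sup>2) = 1}"
    by simp
  moreover have "{x \<in> topspace (disc n). (\<Sum>i<n. (x i)\<^sup>2) = 1} = topspace (bsphere n)"
    by (auto simp: disc_def bsphere_def)
  ultimately show ?thesis by simp
qed

lemma closedin_bsphere_imp_disc:
  assumes "closedin (bsphere n) C"
  shows "closedin (disc n) C"
  using assms closedin_bsphere bsphere_eq_subtopology closedin_trans_full by metis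

section \<open>Closed sets of pushouts and sequential colimits\<close>

lemma closedin_attach:
  "closedin (attach n Y p B) C \<longleftrightarrow>
    C \<subseteq> attach_set n Y p B \<and>
    closedin Y (C \<inter> topspace Y) \<and>
    (\<forall>(\<alpha>, \<beta>) \<in> squares n Y p B.
       closedin (disc n) {x \<in> topspace (disc n). char_map n \<alpha> \<beta> x \<in> C})"
proof -
  let ?U = "attach_set n Y p B - C"
  have "?U \<inter> topspace Y = topspace Y - C \<inter> topspace Y"
    by (auto simp: attach_set_def)
  \<comment> \<open>Characteristic maps send the disc into \<open>attach_set\<close>, so preimages
    commute with complements.\<close>
  moreover have "{x \<in> topspace (disc n). char_map n \<alpha> \<beta> x \<in> ?U} =
      topspace (disc n) - {x \<in> topspace (disc n). char_map n \<alpha> \<beta> x \<in> C}"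
    if "(\<alpha>, \<beta>) \<in> squares n Y p B" for \<alpha> \<beta>
    using char_map_in_attach_set[OF that] by auto
  ultimately show ?thesis
    by (auto simp: closedin_def openin_attach topspace_attach)
qed

lemma closedin_seq_colimit:
  assumes "is_seq_colimit sk X"
  shows "closedin X C \<longleftrightarrow> C \<subseteq> topspace X \<and> (\<forall>n. closedin (sk n) (C \<inter> topspace (sk n)))"
proof -
  have top: "topspace X = (\<Union>n. topspace (sk n))"
    and op: "\<And>U. U \<subseteq> topspace X \<Longrightarrow>
      openin X U \<longleftrightarrow> (\<forall>n. openin (sk n) (U \<inter> topspace (sk n)))"
    using assms by (auto simp: is_seq_colimit_def)
  have "(topspace X - C) \<inter> topspace (sk n) = topspace (sk n) - C \<inter> topspace (sk n)" for n
    using top by auto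
  then show ?thesis
    by (auto simp: closedin_def op)
qed

section \<open>Points and cell structure of the factorization\<close>

lemma topspace_factor_space: "topspace (factor_space A p B) = (\<Union>n. topspace (stage A p B n))"
  using is_seq_colimit_factor_space[of A p B] by (simp add: is_seq_colimit_def)

lemma Base_in_stage: "Base a \<in> topspace (stage A p B n) \<longleftrightarrow> a \<in> topspace A"
  by (induction n)
    (auto simp: topspace_stage_0 topspace_attach attach_set_def simp del: stage.simps(1))

text \<open>A point records its dimension \<open>m\<close> and its square, so it can enter only from
  stage \<open>m\<close> to \<open>Suc m\<close>, and it stays from then on.\<close>

lemma Cell_in_stage:
  "Cell m \<alpha> \<beta> x \<in> topspace (stage A p B n) \<longleftrightarrow>
    m < n \<and> (\<alpha>, \<beta>) \<in> squares m (stage A p B m) p B \<and> x \<in> open_disc m"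
  by (induction n)
    (auto simp: topspace_stage_0 topspace_attach attach_set_def less_Suc_eq simp del: stage.simps(1))

lemma attaches_cells_stage:
  "attaches_cells n (stage A p B n) (stage A p B (Suc n)) (factor_cells A p B n)"
proof -
  let ?Y = "stage A p B n" and ?X = "stage A p B (Suc n)" and ?C = "factor_cells A p B n"
  have X: "?X = attach n ?Y p B" by simp
  have "continuous_map (bsphere n) ?Y \<Phi>" if \<Phi>: "\<Phi> \<in> ?C" for \<Phi>
  proof -
    obtain \<alpha> \<beta> where sq: "(\<alpha>, \<beta>) \<in> squares n ?Y p B" and "\<Phi> = char_map n \<alpha> \<beta>"
      using \<Phi> by (auto simp: factor_cells_def)
    then show ?thesis
      using topspace_bsphere_subset
      by (intro continuous_map_eq[OF squareD(1)[OF sq]]) (auto simp: char_map_def)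
  qed
  moreover have "bij_betw (\<lambda>(\<Phi>, x). \<Phi> x) (?C \<times> open_disc n) (topspace ?X - topspace ?Y)"
    unfolding bij_betw_def
  proof
    show "inj_on (\<lambda>(\<Phi>, x). \<Phi> x) (?C \<times> open_disc n)"
      \<comment> \<open>On the open disc \<open>char_map n \<alpha> \<beta> x\<close> is
        \<open>Cell n \<alpha> \<beta> x\<close>, and the injective constructor recovers both square
        and point.\<close>
      by (auto simp: inj_on_def factor_cells_def char_map_def)
    have "topspace ?X - topspace ?Y =
        {Cell n \<alpha> \<beta> x | \<alpha> \<beta> x. (\<alpha>, \<beta>) \<in> squares n ?Y p B \<and> x \<in> open_disc n}"
      unfolding X topspace_attach attach_set_def by (auto dest: stage_cells_below)
    also have "\<dots> = (\<lambda>(\<Phi>, x). \<Phi> x) ` (?C \<times> open_disc n)" (is "?L = ?R")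
    proof (intro subset_antisym subsetI)
      fix y assume "y \<in> ?L"
      then obtain \<alpha> \<beta> x where "(\<alpha>, \<beta>) \<in> squares n ?Y p B" and x: "x \<in> open_disc n"
        and "y = Cell n \<alpha> \<beta> x" by blast
      then have "char_map n \<alpha> \<beta> \<in> ?C" "y = char_map n \<alpha> \<beta> x"
        by (auto simp: factor_cells_def char_map_def)
      with x show "y \<in> ?R" by (intro image_eqI[of _ _ "(char_map n \<alpha> \<beta>, x)"]) auto
    next
      fix y assume "y \<in> ?R"
      then show "y \<in> ?L" by (auto simp: factor_cells_def char_map_def)
    qed
    finally show "(\<lambda>(\<Phi>, x). \<Phi> x) ` (?C \<times> open_disc n) = topspace ?X - topspace ?Y" ..
  qed
  moreover have "topspace ?Y \<subseteq> topspace ?X"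
    by (auto simp: topspace_attach attach_set_def)
  moreover have "openin ?X U \<longleftrightarrow> openin ?Y (U \<inter> topspace ?Y) \<and>
      (\<forall>\<Phi>\<in>?C. openin (disc n) {x \<in> topspace (disc n). \<Phi> x \<in> U})"
    if "U \<subseteq> topspace ?X" for U
    using that unfolding X topspace_attach openin_attach factor_cells_def by auto
  ultimately show ?thesis
    unfolding attaches_cells_def by blast
qed

lemma CW_complex_tilde: "CW_complex (tilde B) (tilde_cells B)"
proof -
  let ?sk = "stage (trivial_topology :: unit topology) (\<lambda>_. undefined) B"
  have "topspace (?sk 0) = {}"
    by (simp only: topspace_stage_0 topspace_discrete_topology image_empty)
  then have "?sk 0 = trivial_topology"
    by (simp only: null_topspace_iff_trivial)
  then show ?thesis
    unfolding CW_complex_def tilde_def tilde_cells_def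
    using attaches_cells_stage is_seq_colimit_factor_space by blast
qed

lemma Union_open_cells_eq:
  assumes "attaches_cells n Y X (C n)"
  shows "\<Union>(open_cells C n) = topspace X - topspace Y"
proof -
  have "(\<lambda>(\<Phi>, x). \<Phi> x) ` (C n \<times> open_disc n) = topspace X - topspace Y"
    using assms unfolding attaches_cells_def bij_betw_def by (elim conjE)
  moreover have "\<Union>((\<lambda>\<Phi>. \<Phi> ` U) ` C n) = (\<lambda>(\<Phi>, x). \<Phi> x) ` (C n \<times> U)" for U
    by (auto simp: image_iff)
  ultimately show ?thesis
    unfolding open_cells_def by simp
qed

text \<open>Each skeleton adds exactly its open cells to the previous one, and the first skeleton is
  empty, so the differences telescope.\<close>

lemma Union_open_cells:
  assumes "CW_complex X C"
  shows "\<Union>(\<Union>n. open_cells C n) = topspace X"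
proof -
  obtain sk where sk0: "sk 0 = trivial_topology"
    and att: "\<And>n. attaches_cells n (sk n) (sk (Suc n)) (C n)"
    and colim: "is_seq_colimit sk X"
    using assms unfolding CW_complex_def by (elim exE conjE) iprover
  have cells: "\<Union>(open_cells C n) = topspace (sk (Suc n)) - topspace (sk n)" for n
    by (rule Union_open_cells_eq[OF att])
  have "topspace (sk n) \<subseteq> (\<Union>n. \<Union>(open_cells C n))" for n
  proof (induction n)
    case (Suc n)
    have "topspace (sk (Suc n)) \<subseteq> topspace (sk n) \<union> \<Union>(open_cells C n)"
      using cells[of n] by simp
    with Suc show ?case by blast
  qed (simp add: sk0)
  moreover have "(\<Union>n. \<Union>(open_cells C n)) \<subseteq> (\<Union>n. topspace (sk n))"
    unfolding cells by auto
  moreover have "topspace X = (\<Union>n. topspace (sk n))"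
    using colim unfolding is_seq_colimit_def by (elim conjE)
  ultimately have "topspace X = (\<Union>n. \<Union>(open_cells C n))"
    by (simp add: UN_subset_iff subset_antisym)
  then show ?thesis by auto
qed

section \<open>Comparison of the stages over a subspace and over the whole space\<close>

text \<open>\<open>induced\<close> restricts its composites to sphere and disc. Squares consist of
  extensional maps, so this restriction returns them unchanged; for an arbitrary \<open>Cell\<close>
  it need not.\<close>

lemma induced_id_stage:
  assumes "y \<in> topspace (stage A p B n)"
  shows "induced (\<lambda>a. a) (\<lambda>x. x) y = y"
  using assms
proof (induction n arbitrary: y)
  case 0
  then show ?case unfolding topspace_stage_0 by auto
next
  case (Suc n)
  consider "y \<in> topspace (stage A p B n)"
    | \<alpha> \<beta> x where "(\<alpha>, \<beta>) \<in> squares n (stage A p B n) p B" "y = Cell n \<alpha> \<beta> x"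
    using Suc.prems by (auto simp: topspace_attach attach_set_def)
  then show ?case
  proof cases
    case 1
    then show ?thesis by (rule Suc.IH)
  next
    case 2
    \<comment> \<open>The attaching map lands in the previous stage, where the induction hypothesis
      applies pointwise.\<close>
    have "\<alpha> s \<in> topspace (stage A p B n)" if "s \<in> topspace (bsphere n)" for s
      using squareD(1)[OF 2(1)] that by (auto simp: continuous_map_def)
    moreover have "\<alpha> \<in> extensional (topspace (bsphere n))" "\<beta> \<in> extensional (topspace (disc n))"
      using 2(1) by (auto simp: squares_def)
    ultimately have "restrict (induced (\<lambda>a. a) (\<lambda>x. x) \<circ> \<alpha>) (topspace (bsphere n)) = \<alpha>"
      and "restrict ((\<lambda>x. x) \<circ> \<beta>) (topspace (disc n)) = \<beta>"
      by (auto simp: Suc.IH restrict_def extensional_def fun_eq_iff)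
    then show ?thesis
      unfolding 2(2) by simp
  qed
qed

lemma continuous_map_stage_subtopology:
  "continuous_map (stage A p (subtopology B S) n) (stage A p B n) (\<lambda>y. y)"
proof (rule continuous_map_eq)
  show "continuous_map (stage A p (subtopology B S) n) (stage A p B n) (induced (\<lambda>a. a) (\<lambda>x. x))"
    by (rule induced_stage) (auto simp: continuous_map_from_subtopology)
qed (rule induced_id_stage)

lemma squares_subtopology:
  "squares n (stage A p (subtopology B S) n) p (subtopology B S) \<subseteq> squares n (stage A p B n) p B"
proof
  fix sq assume "sq \<in> squares n (stage A p (subtopology B S) n) p (subtopology B S)"
  then obtain \<alpha> \<beta> where "sq = (\<alpha>, \<beta>)"
    and sq: "(\<alpha>, \<beta>) \<in> squares n (stage A p (subtopology B S) n) p (subtopology B S)"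
    by (cases sq) auto
  moreover have "continuous_map (bsphere n) (stage A p B n) \<alpha>"
    using continuous_map_compose[OF squareD(1)[OF sq] continuous_map_stage_subtopology]
    by (simp add: o_def)
  moreover have "continuous_map (disc n) B \<beta>"
    using squareD(2)[OF sq] by (simp add: continuous_map_in_subtopology)
  ultimately show "sq \<in> squares n (stage A p B n) p B"
    by (simp add: squares_def)
qed

lemma stage_subtopology_subset:
  "topspace (stage A p (subtopology B S) n) \<subseteq> topspace (stage A p B n)"
  using continuous_map_image_subset_topspace[OF continuous_map_stage_subtopology] by simp

text \<open>For a cell point, the stage over \<open>B\<close> bounds the dimension by
  \<open>n\<close>, and the stage over the subspace supplies the square; together they place the
  point in stage \<open>n\<close> over the subspace.\<close>

lemma stage_subtopology_Int:
  "topspace (stage A p (subtopology B S) m) \<inter> topspace (stage A p B n) \<subseteq>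
    topspace (stage A p (subtopology B S) n)"
proof
  fix y assume "y \<in> topspace (stage A p (subtopology B S) m) \<inter> topspace (stage A p B n)"
  then show "y \<in> topspace (stage A p (subtopology B S) n)"
    by (cases y) (simp_all add: Base_in_stage Cell_in_stage del: stage.simps)
qed

lemma closedin_stage_subtopology:
  assumes "closedin (stage A p (subtopology B S) n) C"
  shows "closedin (stage A p B n) C"
  using assms
proof (induction n arbitrary: C)
  case 0
  \<comment> \<open>Stage 0 is a copy of \<open>A\<close> and does not involve \<open>B\<close>, so
    both spaces coincide.\<close>
  then show ?case by simp
next
  case (Suc n)
  let ?Y = "stage A p (subtopology B S) n" and ?Y' = "stage A p B n"
  let ?sq = "squares n ?Y p (subtopology B S)" and ?sq' = "squares n ?Y' p B"
  have C: "C \<subseteq> topspace (stage A p (subtopology B S) (Suc n))"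
    using Suc.prems by (rule closedin_subset)
  have closed: "closedin ?Y (C \<inter> topspace ?Y)"
    "\<And>\<alpha> \<beta>. (\<alpha>, \<beta>) \<in> ?sq \<Longrightarrow>
      closedin (disc n) {x \<in> topspace (disc n). char_map n \<alpha> \<beta> x \<in> C}"
    using Suc.prems by (auto simp: closedin_attach)
  \<comment> \<open>No point of \<open>C\<close> becomes older over \<open>B\<close>: those already
    in \<open>?Y'\<close> are in \<open>?Y\<close>, so the induction hypothesis covers them.\<close>
  have "C \<inter> topspace ?Y' = C \<inter> topspace ?Y"
    using C stage_subtopology_Int[of A p B S "Suc n" n] stage_subtopology_subset[of A p B S n]
    by blast
  with Suc.IH[OF closed(1)] have Y': "closedin ?Y' (C \<inter> topspace ?Y')"
    by simp
  have "closedin (disc n) {x \<in> topspace (disc n). char_map n \<alpha> \<beta> x \<in> C}"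
    if sq': "(\<alpha>, \<beta>) \<in> ?sq'" for \<alpha> \<beta>
  proof (cases "(\<alpha>, \<beta>) \<in> ?sq")
    case True
    then show ?thesis by (rule closed(2))
  next
    case False
    then have "Cell n \<alpha> \<beta> x \<notin> C" for x
      using C Cell_in_stage by blast
    moreover have "\<alpha> x \<in> topspace ?Y'" if "x \<in> topspace (bsphere n)" for x
      using squareD(1)[OF sq'] that by (auto simp: continuous_map_def)
    \<comment> \<open>Only sphere points remain, where \<open>char_map\<close> is
      \<open>\<alpha>\<close>. Intersecting with \<open>topspace ?Y'\<close> makes this the preimage
      of a set known to be closed.\<close>
    ultimately have "{x \<in> topspace (disc n). char_map n \<alpha> \<beta> x \<in> C} =
        {x \<in> topspace (bsphere n). \<alpha> x \<in> C \<inter> topspace ?Y'}"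
      using topspace_bsphere_subset by (auto simp: char_map_def)
    then show ?thesis
      using closedin_bsphere_imp_disc[OF closedin_continuous_map_preimage[OF squareD(1)[OF sq'] Y']]
      by simp
  qed
  then show ?case
    using Y' C stage_subtopology_subset[of A p B S "Suc n"]
    by (auto simp: closedin_attach topspace_attach)
qed

section \<open>Passage to the colimit and the subcomplex\<close>

lemma closedin_factor_space_subtopology:
  assumes "closedin (factor_space A p (subtopology B S)) C"
  shows "closedin (factor_space A p B) C"
proof -
  let ?Y = "stage A p (subtopology B S)" and ?Y' = "stage A p B"
  have C: "C \<subseteq> (\<Union>n. topspace (?Y n))" "\<And>n. closedin (?Y n) (C \<inter> topspace (?Y n))"
    using assms
    by (auto simp: closedin_seq_colimit[OF is_seq_colimit_factor_space] topspace_factor_space)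
  have "C \<inter> topspace (?Y' n) = C \<inter> topspace (?Y n)" for n
    using C(1) stage_subtopology_Int[of A p B S _ n] stage_subtopology_subset[of A p B S n]
    by blast
  then have "closedin (?Y' n) (C \<inter> topspace (?Y' n))" for n
    using closedin_stage_subtopology[OF C(2)] by simp
  moreover have "C \<subseteq> (\<Union>n. topspace (?Y' n))"
    using C(1) stage_subtopology_subset[of A p B S] by blast
  ultimately show ?thesis
    by (simp add: closedin_seq_colimit[OF is_seq_colimit_factor_space] topspace_factor_space)
qed

text \<open>\<open>char_map\<close> depends on the square alone, not on the target space, so the
  same functions serve as characteristic maps over \<open>B\<close>.\<close>

lemma factor_cells_subtopology: "factor_cells A p (subtopology B S) n \<subseteq> factor_cells A p B n"
  unfolding factor_cells_def by (rule image_mono[OF squares_subtopology])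

theorem theorem2p4:
  fixes B' :: "'b topology" and S :: "'b set"
  assumes "S \<subseteq> topspace B'"
  shows "inclusion_of_subcomplex
    (tilde (subtopology B' S)) (tilde_cells (subtopology B' S))
    (tilde B') (tilde_cells B')
    (tilde_map (\<lambda>x. x))"
proof -
  let ?B = "subtopology B' S" and ?f = "tilde_map (\<lambda>x::'b. x)"
  have id: "?f y = y" if "y \<in> topspace (tilde ?B)" for y
    using that induced_id_stage
    unfolding tilde_map_def tilde_def topspace_factor_space id_def by blast
  then have im: "?f ` U = U" if "U \<subseteq> topspace (tilde ?B)" for U
    using that by (force simp: subset_iff)
  have closed: "closedin (tilde B') U" if "closedin (tilde ?B) U" for U
    using that closedin_factor_space_subtopology unfolding tilde_def by blast
  have cells: "open_cells (tilde_cells ?B) n \<subseteq> open_cells (tilde_cells B') n" for n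
    unfolding open_cells_def tilde_cells_def by (rule image_mono[OF factor_cells_subtopology])
  note union = Union_open_cells[OF CW_complex_tilde, of ?B]
  have "continuous_map (tilde ?B) (tilde B') ?f"
    by (rule tilde_square(2)) (simp add: continuous_map_from_subtopology)
  \<comment> \<open>As \<open>?f\<close> fixes every point, the image of a closed set is that set
    itself, which stays closed in the larger colimit.\<close>
  moreover have "closed_map (tilde ?B) (tilde B') ?f"
    unfolding closed_map_def using closed closedin_subset im by metis
  moreover have "inj_on ?f (topspace (tilde ?B))"
    using id by (simp add: inj_on_def)
  ultimately have "embedding_map (tilde ?B) (tilde B') ?f"
    by (rule injective_closed_imp_embedding_map)
  moreover have "subcomplex (tilde B') (tilde_cells B') (?f ` topspace (tilde ?B))"
    unfolding subcomplex_def im[OF subset_refl]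
  proof (intro conjI exI)
    show "closedin (tilde B') (topspace (tilde ?B))"
      by (rule closed) simp
    \<comment> \<open>The witness for \<open>K\<close> is the set of all open cells of
      \<open>tilde ?B\<close>, which together exhaust that space.\<close>
    show "(\<Union>n. open_cells (tilde_cells ?B) n) \<subseteq> (\<Union>n. open_cells (tilde_cells B') n)"
      using cells by blast
    show "topspace (tilde ?B) = \<Union>(\<Union>n. open_cells (tilde_cells ?B) n)"
      using union by simp
  qed
  moreover have "?f ` e \<in> open_cells (tilde_cells B') n"
    if "e \<in> open_cells (tilde_cells ?B) n" for n e
  proof -
    \<comment> \<open>This containment makes \<open>?f\<close> fix \<open>e\<close> setwise, so
      \<open>e\<close> only has to be a cell of \<open>tilde B'\<close>.\<close>
    have "e \<subseteq> topspace (tilde ?B)"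
      using that union by blast
    then show ?thesis
      using that cells im by fastforce
  qed
  ultimately show ?thesis
    unfolding inclusion_of_subcomplex_def by (simp add: CW_complex_tilde)
qed

end
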